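(* Let $\{P_n\}_{n\geq 0}$ be the sequence defined by $P_0=1$, $P_1=8$ and, for $n\geq 1$, $(n+1)^2P_{n+1}=8(3n^2+3n+1)P_n-128n^2P_{n-1}$. Then the sequence $\{\sqrt[n]{P_n}\}_{n\geq 1}$ is strictly log-concave, that is, for all $n\geq 2$, $$\left(\sqrt[n]{P_n}\right)^2>\sqrt[n-1]{P_{n-1}}\cdot\sqrt[n+1]{P_{n+1}}.$$
   Context: $\{P_n\}$ is the Catalan-Larcombe-French sequence; all its terms are positive. *)

theory Defs
  imports Complex_Main
begin

end

theory Submission
  imports Defs
begin

text \<open>
  Write \<open>q\<^sub>n = P\<^sub>n / P\<^sub>n\<^sub>-\<^sub>1\<close>. After taking logarithms and multiplying by \<open>n (n - 1) (n + 1)\<close>, the claim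
  becomes \<open>D\<^sub>n > 0\<close> for \<open>D\<^sub>n = n (n + 1) ln q\<^sub>n - n (n - 1) ln q\<^sub>n\<^sub>+\<^sub>1 - 2 ln P\<^sub>n\<close>. Here \<open>D\<^sub>1 = 0\<close> and
  \<open>D\<^sub>n\<^sub>+\<^sub>1 - D\<^sub>n = n (n + 1) (2 ln q\<^sub>n\<^sub>+\<^sub>1 - ln q\<^sub>n - ln q\<^sub>n\<^sub>+\<^sub>2)\<close>, so it suffices that \<open>q\<close> is strictly
  log-concave. By the recurrence, \<open>q\<^sub>n\<^sub>-\<^sub>1\<close> and \<open>q\<^sub>n\<^sub>+\<^sub>1\<close> are rational functions of \<open>q\<^sub>n\<close>, and the log-concavity
  becomes a polynomial inequality in \<open>n\<close> and \<open>q\<^sub>n\<close>. It holds on the window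
  \<open>16 (n - 2) / n \<le> q\<^sub>n \<le> 16 (n - 1) / n\<close>, which the recurrence preserves for \<open>n \<ge> 5\<close>.
\<close>

text \<open>This is log-concavity of \<open>q\<close> with denominators cleared, at
  \<open>q n = 16 * (n - 1 - w) / n\<close>: \<open>w = 0\<close> is the upper end of the window and
  \<open>w = 1\<close> the lower end.\<close>

lemma log_concavity_polynomial_pos:
  fixes n w :: real
  assumes "n \<ge> 5" "0 \<le> w" "w \<le> 1"
  shows "2 * (n - 1 - w)^3 * (n + 1)^2 * (3*n^2 - 3*n + 1 - 2*n*(n - 1 - w))
    > (n - 1)^2 * n^2 * ((3*n^2 + 3*n + 1) * (n - 1 - w) - n^3)" (is "?l > ?r")
proof -
  define m v where "m = n - 5" and "v = 1 - w"
  have nn: "m \<ge> 0" "v \<ge> 0" "w \<ge> 0" and n: "n = m + 5" and v: "v = 1 - w"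
    using assms by (auto simp: m_def v_def)
  let ?c = "1168*v^4 + 14576*w*v^3 + 20304*w^2*v^2 + 8680*w^3*v + 1064*w^4"
  let ?d = "m*(1064*v^4 + 17768*w*v^3 + 29568*w^2*v^2 + 15704*w^3*v + 2456*w^4)
    + m^2*(361*v^4 + 8935*w*v^3 + 17415*w^2*v^2 + 11107*w^3*v + 2198*w^4)
    + m^3*(54*v^4 + 2383*w*v^3 + 5343*w^2*v^2 + 3963*w^3*v + 945*w^4)
    + m^4*(3*v^3 + 355*w*v^2 + 551*w^2*v + 209*w^3)
    + m^5*(29*w*v + 23*w^2) + m^6*w"
  \<comment> \<open>Bernstein form in \<open>w\<close> around \<open>n = 5\<close>: every coefficient is nonnegative.\<close>
  have "?l - ?r = ?c + ?d"
    unfolding n v by algebra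
  \<comment> \<open>Strictness comes from the terms free of \<open>m\<close>: \<open>v\<close> and
    \<open>w\<close> sum to 1, so they cannot both vanish.\<close>
  moreover have "?c > 0"
  proof (cases "w = 0")
    case True
    then show ?thesis using v by simp
  next
    case False
    with nn have "1064 * w^4 > 0" by simp
    moreover have "1168*v^4 + 14576*w*v^3 + 20304*w^2*v^2 + 8680*w^3*v \<ge> 0"
      using nn by (intro add_nonneg_nonneg mult_nonneg_nonneg) auto
    ultimately show ?thesis by linarith
  qed
  moreover have "?d \<ge> 0"
    using nn by (intro add_nonneg_nonneg mult_nonneg_nonneg) auto
  ultimately show ?thesis by linarith
qed

text \<open>Here \<open>x\<close>, \<open>y\<close>, \<open>z\<close> stand for
  \<open>q (n - 1)\<close>, \<open>q n\<close>, \<open>q (n + 1)\<close>, linked by the recurrences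
  at \<open>n - 1\<close> and \<open>n\<close>.\<close>

lemma log_concavity_step:
  fixes n x y z :: real
  assumes n: "n \<ge> 5" and x: "x > 0"
    and lower: "16 * (n - 2) / n \<le> y" and upper: "y \<le> 16 * (n - 1) / n"
    and yx: "n^2 * y * x = 8 * (3*n^2 - 3*n + 1) * x - 128 * (n - 1)^2"
    and zy: "(n + 1)^2 * z * y = 8 * (3*n^2 + 3*n + 1) * y - 128 * n^2"
  shows "x * z < y^2"
proof -
  define w where "w = n - 1 - n * y / 16"
  have w: "0 \<le> w" "w \<le> 1" and y: "y = 16 * (n - 1 - w) / n"
    using n lower upper by (auto simp: w_def field_simps)
  have ypos: "y > 0"
    using lower n by (smt (verit) divide_pos_pos)
  define A where "A = 8 * (3*n^2 - 3*n + 1) - n^2 * y"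
  have Ax: "A * x = 128 * (n - 1)^2"
    using yx by (simp add: A_def algebra_simps)
  moreover have "128 * (n - 1)^2 > 0"
    using n by simp
  ultimately have A: "A > 0"
    using x by (metis zero_less_mult_pos2)
  \<comment> \<open>The factors of \<open>c\<close> are the coefficients of \<open>x\<close> and
    \<open>z\<close> in the two recurrences, so \<open>c * (x * z)\<close> reduces to an expression
    in \<open>n\<close> and \<open>y\<close> alone.\<close>
  define c where "c = A * ((n + 1)^2 * y)"
  have c: "c > 0" using A ypos n by (simp add: c_def)
  have "c * (x * z) = (A * x) * ((n + 1)^2 * z * y)"
    by (simp add: c_def)
  also have "\<dots> = 16384 / n^3 * ((n - 1)^2 * n^2 * ((3*n^2 + 3*n + 1) * (n - 1 - w) - n^3))"
    unfolding Ax zy unfolding y using n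
    by (simp add: divide_simps) algebra
  also have "\<dots> < 16384 / n^3 *
      (2 * (n - 1 - w)^3 * (n + 1)^2 * (3*n^2 - 3*n + 1 - 2*n*(n - 1 - w)))"
    using n w log_concavity_polynomial_pos[of n w] by (intro mult_strict_left_mono) auto
  also have "\<dots> = c * y^2"
    unfolding c_def A_def unfolding y using n
    by (simp add: divide_simps) algebra
  finally show ?thesis using c by simp
qed

locale catalan_larcombe_french =
  fixes P :: "nat \<Rightarrow> real"
  assumes P0: "P 0 = 1"
    and P1: "P 1 = 8"
    and rec: "\<And>n::nat. n \<ge> 1 \<Longrightarrow>
      (real n + 1)^2 * P (n + 1)
        = 8 * (3 * (real n)^2 + 3 * real n + 1) * P n - 128 * (real n)^2 * P (n - 1)"
begin

text \<open>Positivity alone is not inductive because of the subtracted term. The factor 8 controls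
  that term and reproduces itself with surplus \<open>8 * t * P (Suc n)\<close>.\<close>

lemma growth: "P n > 0 \<and> P (Suc n) \<ge> 8 * P n"
proof (induction n)
  case 0
  then show ?case using P0 P1 by simp
next
  case (Suc n)
  define t where "t = real (Suc n)"
  have t: "t \<ge> 1" by (simp add: t_def)
  have pos: "P (Suc n) > 0" using Suc by linarith
  have "(t + 1)^2 * P (Suc (Suc n)) = 8 * (3*t^2 + 3*t + 1) * P (Suc n) - 16 * t^2 * (8 * P n)"
    using rec[of "Suc n"] by (simp add: t_def)
  also have "\<dots> \<ge> 8 * (3*t^2 + 3*t + 1) * P (Suc n) - 16 * t^2 * P (Suc n)"
    using Suc by (intro diff_left_mono mult_left_mono) auto
  also have "8 * (3*t^2 + 3*t + 1) * P (Suc n) - 16 * t^2 * P (Suc n)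
      = (t + 1)^2 * (8 * P (Suc n)) + 8 * t * P (Suc n)"
    by algebra
  finally have "(t + 1)^2 * (8 * P (Suc n)) \<le> (t + 1)^2 * P (Suc (Suc n))"
    using t pos by (smt (verit) mult_nonneg_nonneg)
  then show ?case using t pos by simp
qed

lemma P_pos: "P n > 0"
  using growth by blast

definition q :: "nat \<Rightarrow> real" where "q n = P n / P (n - 1)"

lemma q_pos: "q n > 0"
  by (simp add: q_def P_pos)

lemma q_rec:
  assumes "n \<ge> 1"
  shows "(real n + 1)^2 * q (n + 1) * q n = 8 * (3 * (real n)^2 + 3 * real n + 1) * q n - 128 * (real n)^2"
proof -
  have "(real n + 1)^2 * q (n + 1) * q n = ((real n + 1)^2 * P (n + 1)) / P (n - 1)"
    using P_pos[of n] by (simp add: q_def)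
  then show ?thesis
    unfolding rec[OF assms] using P_pos[of "n - 1"] by (simp add: q_def diff_divide_distrib)
qed

lemma q_Suc:
  assumes "n \<ge> 1"
  shows "q (Suc n) = (8 * (3 * (real n)^2 + 3 * real n + 1) - 128 * (real n)^2 / q n) / (real n + 1)^2"
  using q_rec[OF assms] q_pos[of n] by (simp add: field_simps)

text \<open>The window starts only at 5: \<open>q 4 = 169 / 14\<close> exceeds 12, its upper bound
  at 4. These values settle the smaller cases and start the induction.\<close>

lemma q_values:
  "q 1 = 8" "q 2 = 10" "q 3 = 56 / 5" "q 4 = 169 / 14" "q 5 = 10760 / 845"
proof -
  show 1: "q 1 = 8" using P0 P1 by (simp add: q_def)
  show 2: "q 2 = 10" using q_Suc[of 1] 1 by (simp add: numeral_2_eq_2)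
  show 3: "q 3 = 56 / 5" using q_Suc[of 2] 2 by simp
  show 4: "q 4 = 169 / 14" using q_Suc[of 3] 3 by simp
  show "q 5 = 10760 / 845" using q_Suc[of 4] 4 by simp
qed

text \<open>By the recurrence \<open>q (Suc n)\<close> increases with \<open>q n\<close>, so it
  suffices to follow the two endpoints of the window.\<close>

lemma q_bounds:
  assumes "n \<ge> 5"
  shows "16 * (real n - 2) / n \<le> q n \<and> q n \<le> 16 * (real n - 1) / n"
  using assms
proof (induction n rule: dec_induct)
  case base
  then show ?case by (simp add: q_values)
next
  case (step n)
  define t where "t = real n"
  have t: "t \<ge> 5" using step by (simp add: t_def)
  have q: "q (Suc n) = (8 * (3*t^2 + 3*t + 1) - 128 * t^2 / q n) / (t + 1)^2"
    using q_Suc[of n] step by (simp add: t_def)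
  have IH: "16 * (t - 2) / t \<le> q n" "q n \<le> 16 * (t - 1) / t"
    using step by (simp_all add: t_def)
  have a: "128 * t^2 / q n \<le> 8 * t^3 / (t - 2)"
  proof -
    have "128 * t^2 / q n \<le> 128 * t^2 / (16 * (t - 2) / t)"
      using IH t q_pos by (intro divide_left_mono mult_pos_pos divide_pos_pos) auto
    also have "\<dots> = 8 * t^3 / (t - 2)" using t by (simp add: field_simps power2_eq_square power3_eq_cube)
    finally show ?thesis .
  qed
  have b: "8 * t^3 / (t - 1) \<le> 128 * t^2 / q n"
  proof -
    have "8 * t^3 / (t - 1) = 128 * t^2 / (16 * (t - 1) / t)"
      using t by (simp add: field_simps power2_eq_square power3_eq_cube)
    also have "\<dots> \<le> 128 * t^2 / q n"
      using IH t q_pos by (intro divide_left_mono mult_pos_pos divide_pos_pos) auto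
    finally show ?thesis .
  qed
  \<comment> \<open>For the lower endpoint the margin is \<open>8 * (t^2 - 3*t - 6)\<close>, which
    is negative at \<open>t = 4\<close> and positive from 5 on.\<close>
  have "16 * (t - 1) * (t + 1) * (t - 2) + 8 * t^3 \<le> 8 * (3*t^2 + 3*t + 1) * (t - 2)"
  proof -
    have "8 * (3*t^2 + 3*t + 1) * (t - 2) - (16 * (t - 1) * (t + 1) * (t - 2) + 8 * t^3)
        = 8 * (t * (t - 5) + 2 * (t - 5) + 4)"
      by algebra
    also have "\<dots> \<ge> 0" using t by (intro mult_nonneg_nonneg add_nonneg_nonneg) auto
    finally show ?thesis by linarith
  qed
  then have "16 * (t - 1) * (t + 1) \<le> 8 * (3*t^2 + 3*t + 1) - 8 * t^3 / (t - 2)"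
    using t by (simp add: field_simps)
  with a have "16 * (t - 1) * (t + 1) \<le> 8 * (3*t^2 + 3*t + 1) - 128 * t^2 / q n"
    by linarith
  then have l: "16 * (t - 1) / (t + 1) \<le> q (Suc n)"
    unfolding q using t by (simp add: divide_simps power2_eq_square)
  \<comment> \<open>For the upper endpoint the margin is the constant 8.\<close>
  have "8 * (3*t^2 + 3*t + 1) * (t - 1) = 16 * t * (t + 1) * (t - 1) + 8 * t^3 - 8"
    by algebra
  then have "8 * (3*t^2 + 3*t + 1) - 8 * t^3 / (t - 1) \<le> 16 * t * (t + 1)"
    using t by (simp add: field_simps)
  with b have "8 * (3*t^2 + 3*t + 1) - 128 * t^2 / q n \<le> 16 * t * (t + 1)"
    by linarith
  then have u: "q (Suc n) \<le> 16 * t / (t + 1)"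
    unfolding q using t by (simp add: divide_simps power2_eq_square)
  from l u show ?case by (simp add: t_def add.commute)
qed

lemma q_strictly_log_concave:
  assumes "n \<ge> 2"
  shows "q (n - 1) * q (n + 1) < (q n)^2"
proof -
  consider "n = 2" | "n = 3" | "n = 4" | "n \<ge> 5" using assms by linarith
  then show ?thesis
  proof cases
    case 4
    then have n: "real n \<ge> 5" and r: "real (n - 1) = real n - 1" "n - 1 + 1 = n" by auto
    show ?thesis
    proof (rule log_concavity_step[OF n q_pos])
      show "(real n)^2 * q n * q (n - 1)
          = 8 * (3 * (real n)^2 - 3 * real n + 1) * q (n - 1) - 128 * (real n - 1)^2"
        using q_rec[of "n - 1", unfolded r] 4 by (simp add: power2_eq_square algebra_simps)
      show "(real n + 1)^2 * q (n + 1) * q n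
          = 8 * (3 * (real n)^2 + 3 * real n + 1) * q n - 128 * (real n)^2"
        using q_rec[of n] 4 by simp
    qed (use q_bounds[OF 4] in auto)
  qed (simp_all add: q_values(2-) q_values(1)[unfolded One_nat_def] power2_eq_square)
qed

definition D :: "nat \<Rightarrow> real" where
  "D n = real n * (real n + 1) * ln (q n) - real n * (real n - 1) * ln (q (n + 1)) - 2 * ln (P n)"

lemma ln_P_Suc: "ln (P (Suc n)) = ln (P n) + ln (q (Suc n))"
  using P_pos[of n] P_pos[of "Suc n"] by (simp add: q_def ln_div)

lemma D_less_Suc:
  assumes "n \<ge> 1"
  shows "D n < D (Suc n)"
proof -
  have "ln (q n * q (n + 2)) < ln ((q (Suc n))^2)"
    using q_strictly_log_concave[of "Suc n"] assms q_pos[THEN less_imp_neq, symmetric] q_pos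
    by (subst ln_less_cancel_iff) auto
  then have *: "ln (q n) + ln (q (n + 2)) < 2 * ln (q (Suc n))"
    using q_pos[of n] q_pos[of "n + 2"] q_pos[of "Suc n"] by (simp add: ln_mult ln_realpow)
  \<comment> \<open>The \<open>ln P\<close> terms leave \<open>- 2 * ln (q (Suc n))\<close>, and
    \<open>(n + 1) * (n + 2) + n * (n - 1) - 2 = 2 * n * (n + 1)\<close>.\<close>
  have "D (Suc n) - D n
      = real n * (real n + 1) * (2 * ln (q (Suc n)) - (ln (q n) + ln (q (n + 2))))"
    by (simp add: D_def ln_P_Suc algebra_simps)
  also have "\<dots> > 0" using * assms by simp
  finally show ?thesis by simp
qed

lemma D_pos:
  assumes "n \<ge> 2"
  shows "D n > 0"
  using assms
proof (induction n rule: dec_induct)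
  case base
  have "D 1 = 0" by (simp add: D_def q_def P0)
  then show ?case using D_less_Suc[of 1] by (simp add: numeral_2_eq_2)
next
  case (step n)
  then show ?case using D_less_Suc[of n] by simp
qed

lemma root_P_strictly_log_concave:
  assumes "n \<ge> 2"
  shows "root (n - 1) (P (n - 1)) * root (n + 1) (P (n + 1)) < (root n (P n))^2"
proof -
  define t where "t = real n"
  have t: "t > 1" and tm: "real (n - 1) = t - 1" using assms by (auto simp: t_def)
  have ln1: "ln (P (n - 1)) = ln (P n) - ln (q n)"
    using ln_P_Suc[of "n - 1"] assms by simp
  \<comment> \<open>Over the common denominator \<open>ln (P n)\<close> has coefficient
    \<open>2 * (t^2 - 1) - t * (t + 1) - t * (t - 1) = -2\<close>, the last term of
    \<open>D\<close>.\<close>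
  have "2 * ln (P n) / t - (ln (P (n - 1)) / (t - 1) + ln (P (n + 1)) / (t + 1))
      = D n / (t * (t - 1) * (t + 1))"
    unfolding D_def ln1 using ln_P_Suc[of n] t
    by (simp add: divide_simps flip: t_def) (simp add: algebra_simps)
  also have "\<dots> > 0" using D_pos[OF assms] t by simp
  finally have "ln (P (n - 1)) / (t - 1) + ln (P (n + 1)) / (t + 1) < 2 * (ln (P n) / t)"
    by simp
  also have "ln (P (n - 1)) / (t - 1) + ln (P (n + 1)) / (t + 1)
      = ln (root (n - 1) (P (n - 1)) * root (n + 1) (P (n + 1)))"
    using assms P_pos[THEN less_imp_neq, symmetric] P_pos tm
    by (simp add: ln_mult ln_root t_def add.commute)
  also have "2 * (ln (P n) / t) = ln ((root n (P n))^2)"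
    using assms P_pos by (simp add: ln_realpow ln_root t_def)
  finally show ?thesis using assms P_pos P_pos[THEN less_imp_neq, symmetric]
    by (subst (asm) ln_less_cancel_iff) auto
qed

end

theorem theorem1p1:
  fixes P :: "nat \<Rightarrow> real"
  assumes P0: "P 0 = 1"
    and P1: "P 1 = 8"
    and rec: "\<And>n::nat. n \<ge> 1 \<Longrightarrow>
      (real n + 1)^2 * P (n + 1)
        = 8 * (3 * (real n)^2 + 3 * real n + 1) * P n - 128 * (real n)^2 * P (n - 1)"
  shows "\<forall>n::nat. n \<ge> 2 \<longrightarrow>
    (root n (P n))^2 > root (n - 1) (P (n - 1)) * root (n + 1) (P (n + 1))"
proof -
  interpret catalan_larcombe_french P
    by unfold_locales (fact P0 P1 rec)+
  show ?thesis using root_P_strictly_log_concave by blast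
qed

end
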